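(* Let $0\le k\le n$, let $w^{\odot}\in S_{n,k}^{\odot}$ be a decorated permutation with associated Bruhat interval $[u,v]$ and positroid variety $\Pi_{[u,v]}\subseteq Gr(k,n)$. Suppose $A\in\Pi_{[u,v]}$ is the image $\pi_k(V_\bullet)$ of some flag $V_\bullet\in C_y\cap X^v$ for some $y\in[u,v]$. Then the codimension (in $Gr(k,n)$) of the tangent space to $\Pi_{[u,v]}$ at $A$ is bounded below by $\operatorname{rank}(Jac|_{A_{y[k]}})$.
   Context: $[n]=\{1,\dots,n\}$ and $\binom{[n]}{k}$ is the set of $k$-subsets of $[n]$. $Gr(k,n)$ is the Grassmannian of $k$-dimensional subspaces of $\mathbb{C}^n$; a point is the row span of a full-rank $k\times n$ complex matrix, and for $I\in\binom{[n]}{k}$ the Plücker coordinate $\Delta_I$ is the $k\times k$ minor in the columns $I$. For $J=\{j_1<\dots<j_k\}$, $A_J\in Gr(k,n)$ is the row span of the $k\times n$ matrix with a $1$ in cell $(i,j_i)$ for each $i$ and $0$ elsewhere. For $y\in S_n$, $y[i]=\{y(1),\dots,y(i)\}$. A decorated permutation on $n$ elements is a permutation $w\in S_n$ together with a label "clockwise" or "counterclockwise" on each fixed point. An element $i\in[n]$ is an anti-exceedance if $i<w^{-1}(i)$ or $i$ is a clockwise fixed point; $S_{n,k}^{\odot}$ is the set of decorated permutations on $n$ elements with exactly $k$ anti-exceedances. For $r\in[n]$ let $<_r$ be the order $r<_r r+1<_r\cdots<_r n<_r 1<_r\cdots<_r r-1$, and $I_r(w)=\{i\in[n]: i<_r w^{-1}(i)\text{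 or } i \text{ is a clockwise fixed point}\}$. For $I=\{i_1<_r\dots<_r i_k\}$, $J=\{j_1<_r\dots<_r j_k\}$, write $I\preceq_r J$ if $i_h\le_r j_h$ for all $h$. The positroid of $w^{\odot}$ is $\mathcal{M}=\{I\in\binom{[n]}{k}: I_r(w)\preceq_r I \text{ for all } r\in[n]\}$. The associated Bruhat interval $[u,v]$: $v$ is the unique permutation with $v(1)<\dots<v(k)$, $v(k+1)<\dots<v(n)$ and $\{v(1),\dots,v(k)\}=w^{-1}(I_1(w))$ ($w$ the underlying permutation), and $u=wv$, i.e. $u(i)=w(v(i))$; then $u\le v$ in Bruhat order and $[u,v]=\{y\in S_n: u\le y\le v\}$, where $x\le y$ in Bruhat order iff for each $i$ the sorted elements of $x[i]$ are componentwise $\le$ those of $y[i]$. The flag variety $\mathcal{F}\ell(n)$ consists of complete flags $V_\bullet=(V_1\subset\cdots\subset V_n=\mathbb{C}^n)$, $\dim V_i=i$; $\pi_k(V_\bullet)=V_k\in Gr(k,n)$. With $\mathrm{Proj}_S:\mathbb{C}^n\to\mathbb{C}^{|S|}$ the coordinate projection onto indices $S$, the Schubert cell is $C_y=\{V_\bullet: \dim\mathrm{Proj}_{[j]}(V_i)=|y[i]\cap[j]|\ \forall i,j\}$, the opposite Schubert cell is $C^y=\{V_\bullet:\dim\mathrm{Proj}_{[n-j+1,n]}(V_i)=|y[i]\cap[n-j+1,n]|\ \forall i,j\}$, and $X^v$ is the Zariski closure of $C^v$; $X_u$ is the closure of $C_u$. The positroid variety $\Pi_{[u,v]}$ is the subvariety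 of $Gr(k,n)$ whose vanishing ideal is generated by $\{\Delta_I: I\notin\mathcal{M}\}$; equivalently $\Pi_{[u,v]}=\pi_k(X_u\cap X^v)$. $Jac$ denotes the Jacobian matrix of the defining polynomials $\{\Delta_I: I\notin\mathcal{M}\}$ of $\Pi_{[u,v]}$ (in local coordinates on $Gr(k,n)$), so that for $x\in\Pi_{[u,v]}$, $\operatorname{rank}(Jac|_x)$ is the codimension in $Gr(k,n)$ of the tangent space to $\Pi_{[u,v]}$ at $x$. *)

theory Defs
  imports
    "HOL-Analysis.Derivative"
    "HOL-Combinatorics.Permutations"
    "Jordan_Normal_Form.DL_Rank_Submatrix"
begin

text \<open>
  Indices are 0-based throughout, as in the matrix library: the ground set
  $[n] = \{1,\dots,n\}$ is \<open>{..<n}\<close>, the set $y[i]$ is \<open>y ` {..<i}\<close>, and the cyclic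
  order $<_r$ with $r \in [n]$ is indexed by \<open>r < n\<close>.
\<close>

definition ksubsets :: "nat \<Rightarrow> nat \<Rightarrow> nat set set" where
  "ksubsets n k = {I. I \<subseteq> {..<n} \<and> card I = k}"


subsection \<open>Decorated permutations and positroids\<close>

text \<open>A pair \<open>(w, c)\<close>, where \<open>c\<close> is the set of clockwise fixed points.\<close>

type_synonym dperm = "(nat \<Rightarrow> nat) \<times> nat set"

definition anti_exceedances :: "nat \<Rightarrow> dperm \<Rightarrow> nat set" where
  "anti_exceedances n d = {i \<in> {..<n}. i < inv_into UNIV (fst d) i \<or> i \<in> snd d}"

definition decorated_perms :: "nat \<Rightarrow> nat \<Rightarrow> dperm set" where
  "decorated_perms n k =
    {(w, c). w permutes {..<n} \<and> c \<subseteq> {i \<in> {..<n}. w i = i} \<and>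
             card (anti_exceedances n (w, c)) = k}"

text \<open>The position of \<open>i\<close> in the order \<open>r, r + 1, \<dots>, n - 1, 0, \<dots>, r - 1\<close>.\<close>

definition cyc_pos :: "nat \<Rightarrow> nat \<Rightarrow> nat \<Rightarrow> nat" where
  "cyc_pos n r i = (i + (n - r)) mod n"

definition shifted_anti_exceedances :: "nat \<Rightarrow> nat \<Rightarrow> dperm \<Rightarrow> nat set" where
  "shifted_anti_exceedances n r d =
    {i \<in> {..<n}. cyc_pos n r i < cyc_pos n r (inv_into UNIV (fst d) i) \<or> i \<in> snd d}"

definition cyc_sorted_list :: "nat \<Rightarrow> nat \<Rightarrow> nat set \<Rightarrow> nat list" where
  "cyc_sorted_list n r I = sort_key (cyc_pos n r) (sorted_list_of_set I)"

definition gale_le :: "nat \<Rightarrow> nat \<Rightarrow> nat set \<Rightarrow> nat set \<Rightarrow> bool" where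
  "gale_le n r I J \<longleftrightarrow>
    list_all2 (\<lambda>i j. cyc_pos n r i \<le> cyc_pos n r j) (cyc_sorted_list n r I) (cyc_sorted_list n r J)"

definition positroid :: "nat \<Rightarrow> nat \<Rightarrow> dperm \<Rightarrow> nat set set" where
  "positroid n k d = {I \<in> ksubsets n k. \<forall>r<n. gale_le n r (shifted_anti_exceedances n r d) I}"


subsection \<open>The Bruhat interval of a decorated permutation\<close>

definition bruhat_le :: "nat \<Rightarrow> (nat \<Rightarrow> nat) \<Rightarrow> (nat \<Rightarrow> nat) \<Rightarrow> bool" where
  "bruhat_le n x y \<longleftrightarrow>
    (\<forall>i\<le>n. list_all2 (\<le>) (sorted_list_of_set (x ` {..<i})) (sorted_list_of_set (y ` {..<i})))"

definition bruhat_interval :: "nat \<Rightarrow> (nat \<Rightarrow> nat) \<Rightarrow> (nat \<Rightarrow> nat) \<Rightarrow> (nat \<Rightarrow> nat) set" where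
  "bruhat_interval n u v = {y. y permutes {..<n} \<and> bruhat_le n u y \<and> bruhat_le n y v}"

definition upper_perm :: "nat \<Rightarrow> nat \<Rightarrow> dperm \<Rightarrow> nat \<Rightarrow> nat" where
  "upper_perm n k d = (THE v. v permutes {..<n} \<and> strict_mono_on {..<k} v \<and>
     strict_mono_on {k..<n} v \<and> v ` {..<k} = fst d -` shifted_anti_exceedances n 0 d)"

definition lower_perm :: "nat \<Rightarrow> nat \<Rightarrow> dperm \<Rightarrow> nat \<Rightarrow> nat" where
  "lower_perm n k d = fst d \<circ> upper_perm n k d"


subsection \<open>Grassmannian and positroid varieties\<close>

abbreviation cvs :: "nat \<Rightarrow> (complex, complex vec) module" where
  "cvs n \<equiv> module_vec TYPE(complex) n"

definition subspace_dim :: "nat \<Rightarrow> complex vec set \<Rightarrow> nat" where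
  "subspace_dim n W = vectorspace.dim class_ring (cvs n\<lparr>carrier := W\<rparr>)"

definition Gr :: "nat \<Rightarrow> nat \<Rightarrow> complex vec set set" where
  "Gr k n = {W. VectorSpace.subspace class_ring W (cvs n) \<and> subspace_dim n W = k}"

abbreviation row_span :: "nat \<Rightarrow> complex mat \<Rightarrow> complex vec set" where
  "row_span n M \<equiv> vec_space.row_space n M"

definition minor_cols :: "nat set \<Rightarrow> complex mat \<Rightarrow> complex" where
  "minor_cols I M = det (submatrix M UNIV I)"

definition coord_subspace :: "nat \<Rightarrow> nat set \<Rightarrow> complex vec set" where
  "coord_subspace n J = row_span n (mat (card J) n (\<lambda>(i, j). if j = pick J i then 1 else 0))"

definition positroid_variety :: "nat \<Rightarrow> nat \<Rightarrow> dperm \<Rightarrow> complex vec set set" where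
  "positroid_variety n k d =
    {W \<in> Gr k n. \<forall>I \<in> ksubsets n k - positroid n k d.
       \<forall>M \<in> carrier_mat k n. row_span n M = W \<longrightarrow> minor_cols I M = 0}"


subsection \<open>Polynomial functions\<close>

text \<open>
  Polynomials over $\mathbb{C}$ in the variables \<open>S\<close>, identified with the functions they induce.
\<close>

inductive_set poly_funs :: "'v set \<Rightarrow> (('v \<Rightarrow> complex) \<Rightarrow> complex) set" for S :: "'v set" where
  const: "(\<lambda>x. c) \<in> poly_funs S"
| var: "s \<in> S \<Longrightarrow> (\<lambda>x. x s) \<in> poly_funs S"
| add: "f \<in> poly_funs S \<Longrightarrow> g \<in> poly_funs S \<Longrightarrow> (\<lambda>x. f x + g x) \<in> poly_funs S"
| mult: "f \<in> poly_funs S \<Longrightarrow> g \<in> poly_funs S \<Longrightarrow> (\<lambda>x. f x * g x) \<in> poly_funs S"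

definition partial_deriv :: "'v \<Rightarrow> (('v \<Rightarrow> complex) \<Rightarrow> complex) \<Rightarrow> ('v \<Rightarrow> complex) \<Rightarrow> complex" where
  "partial_deriv s f x = deriv (\<lambda>t. f (x(s := t))) (x s)"

definition jacobian ::
    "nat \<Rightarrow> ((nat \<Rightarrow> complex) \<Rightarrow> complex) list \<Rightarrow> (nat \<Rightarrow> complex) \<Rightarrow> complex mat" where
  "jacobian N fs x = mat (length fs) N (\<lambda>(i, j). partial_deriv j (fs ! i) x)"


subsection \<open>The flag variety\<close>

definition flags :: "nat \<Rightarrow> (nat \<Rightarrow> complex vec set) set" where
  "flags n = {V \<in> (\<Pi>\<^sub>E i\<in>{..n}. Gr i n). \<forall>i<n. V i \<subseteq> V (Suc i)}"

definition flag_proj :: "nat \<Rightarrow> (nat \<Rightarrow> complex vec set) \<Rightarrow> complex vec set" where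
  "flag_proj k V = V k"

definition coord_proj :: "nat set \<Rightarrow> complex vec \<Rightarrow> complex vec" where
  "coord_proj S x = vec (card S) (\<lambda>i. x $ pick S i)"

definition schubert_cell :: "nat \<Rightarrow> (nat \<Rightarrow> nat) \<Rightarrow> (nat \<Rightarrow> complex vec set) set" where
  "schubert_cell n y = {V \<in> flags n. \<forall>i\<le>n. \<forall>j\<le>n.
     subspace_dim j (coord_proj {..<j} ` V i) = card (y ` {..<i} \<inter> {..<j})}"

definition opposite_schubert_cell :: "nat \<Rightarrow> (nat \<Rightarrow> nat) \<Rightarrow> (nat \<Rightarrow> complex vec set) set" where
  "opposite_schubert_cell n y = {V \<in> flags n. \<forall>i\<le>n. \<forall>j\<le>n.
     subspace_dim j (coord_proj {n - j..<n} ` V i) = card (y ` {..<i} \<inter> {n - j..<n})}"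

text \<open>
  The Zariski topology is that of the Pluecker embedding into $\prod_i \mathbb{P}(\bigwedge^i \mathbb{C}^n)$:
  closed sets are cut out by polynomials in the coordinates $p_I$, $\emptyset \neq I \subseteq [n]$,
  that are homogeneous separately in each group $\{p_I : |I| = i\}$. The coordinates of a flag are
  the minors of a matrix whose first $i$ rows span $V_i$ for all $i$, in the first $|I|$ rows and the
  columns $I$.
\<close>

definition flag_matrices :: "nat \<Rightarrow> (nat \<Rightarrow> complex vec set) \<Rightarrow> complex mat set" where
  "flag_matrices n V =
    {g \<in> carrier_mat n n. \<forall>i\<le>n. V i = row_span n (submatrix g {..<i} UNIV)}"

definition flag_coords :: "complex mat \<Rightarrow> nat set \<Rightarrow> complex" where
  "flag_coords g I = det (submatrix g {..<card I} I)"

definition multihomogeneous :: "nat \<Rightarrow> ((nat set \<Rightarrow> complex) \<Rightarrow> complex) set" where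
  "multihomogeneous n = {f \<in> poly_funs {I. I \<subseteq> {..<n} \<and> I \<noteq> {}}.
     \<exists>e :: nat \<Rightarrow> nat. \<forall>c p. f (\<lambda>I. c (card I) * p I) = (\<Prod>i = 1..n. c i ^ e i) * f p}"

definition zariski_closed :: "nat \<Rightarrow> (nat \<Rightarrow> complex vec set) set \<Rightarrow> bool" where
  "zariski_closed n Z \<longleftrightarrow> (\<exists>F \<subseteq> multihomogeneous n.
     Z = {V \<in> flags n. \<forall>f\<in>F. \<forall>g \<in> flag_matrices n V. f (flag_coords g) = 0})"

definition zariski_closure ::
    "nat \<Rightarrow> (nat \<Rightarrow> complex vec set) set \<Rightarrow> (nat \<Rightarrow> complex vec set) set" where
  "zariski_closure n S = \<Inter> {Z. zariski_closed n Z \<and> S \<subseteq> Z}"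

definition opposite_schubert_variety ::
    "nat \<Rightarrow> (nat \<Rightarrow> nat) \<Rightarrow> (nat \<Rightarrow> complex vec set) set" where
  "opposite_schubert_variety n v = zariski_closure n (opposite_schubert_cell n v)"


subsection \<open>Local coordinates, tangent spaces and the Jacobian\<close>

text \<open>
  The standard affine chart of \<open>Gr k n\<close> where the \<open>J\<close>-th Pluecker coordinate is nonzero: the identity
  matrix in the columns \<open>J\<close>, and the \<open>k * (n - k)\<close> coordinates in the remaining columns, numbered row
  by row. Only the entries \<open>x q\<close> with \<open>q < k * (n - k)\<close> are used.
\<close>

definition chart_mat :: "nat \<Rightarrow> nat \<Rightarrow> nat set \<Rightarrow> (nat \<Rightarrow> complex) \<Rightarrow> complex mat" where
  "chart_mat n k J x = mat k n (\<lambda>(a, b).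
     if b \<in> J then (if b = pick J a then 1 else 0)
     else x (a * (n - k) + card {c. c < b \<and> c \<notin> J}))"

definition local_coords :: "nat \<Rightarrow> nat \<Rightarrow> nat set \<Rightarrow> (nat \<Rightarrow> complex) \<Rightarrow> complex vec set \<Rightarrow> bool" where
  "local_coords n k J x W \<longleftrightarrow> J \<in> ksubsets n k \<and> row_span n (chart_mat n k J x) = W"

text \<open>
  The Zariski tangent space at the point with coordinates \<open>x\<close> of a subset \<open>Z\<close> of \<open>Gr k n\<close>, computed
  from the vanishing ideal of \<open>Z\<close> in the chart \<open>J\<close>.
\<close>

definition local_vanishing_ideal ::
    "nat \<Rightarrow> nat \<Rightarrow> complex vec set set \<Rightarrow> nat set \<Rightarrow> ((nat \<Rightarrow> complex) \<Rightarrow> complex) set" where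
  "local_vanishing_ideal n k Z J = {f \<in> poly_funs {..<k * (n - k)}.
     \<forall>x. row_span n (chart_mat n k J x) \<in> Z \<longrightarrow> f x = 0}"

definition tangent_space ::
    "nat \<Rightarrow> nat \<Rightarrow> complex vec set set \<Rightarrow> nat set \<Rightarrow> (nat \<Rightarrow> complex) \<Rightarrow> complex vec set" where
  "tangent_space n k Z J x = {\<xi> \<in> carrier_vec (k * (n - k)).
     \<forall>f \<in> local_vanishing_ideal n k Z J. (\<Sum>q<k * (n - k). partial_deriv q f x * \<xi> $ q) = 0}"

definition tangent_codim ::
    "nat \<Rightarrow> nat \<Rightarrow> complex vec set set \<Rightarrow> nat set \<Rightarrow> (nat \<Rightarrow> complex) \<Rightarrow> nat" where
  "tangent_codim n k Z J x = k * (n - k) - subspace_dim (k * (n - k)) (tangent_space n k Z J x)"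

text \<open>The \<open>k\<close>-subsets outside the positroid, listed once each.\<close>

definition nonbases :: "nat \<Rightarrow> nat \<Rightarrow> dperm \<Rightarrow> nat set list" where
  "nonbases n k d =
    filter (\<lambda>I. card I = k \<and> I \<notin> positroid n k d) (map set (subseqs [0..<n]))"

definition Jac :: "nat \<Rightarrow> nat \<Rightarrow> dperm \<Rightarrow> nat set \<Rightarrow> (nat \<Rightarrow> complex) \<Rightarrow> complex mat" where
  "Jac n k d J x =
    jacobian (k * (n - k)) (map (\<lambda>I x. minor_cols I (chart_mat n k J x)) (nonbases n k d)) x"

definition mat_rank :: "complex mat \<Rightarrow> nat" where
  "mat_rank M = vec_space.rank (dim_row M) M"

end

theory Submission
  imports Defs
begin

text \<open>
  Put $J_0 = y[k]$. The rank conditions of the Schubert cell force $\Delta_{J_0}(A) \neq 0$, so $A$ lies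
  in the affine chart around $A_{J_0}$. In this chart the coordinate $x_{ab}$ is, up to a nonzero
  constant, the minor of $J_0$ with its $a$-th element exchanged for $b$, while all other minors except
  $\Delta_{J_0}$ vanish to order at least two at the origin $A_{J_0}$. Hence the Jacobian at $A_{J_0}$
  has rank at most the number of coordinates $x_{ab}$ whose exchanged set is not in the positroid. These
  coordinates vanish on the positroid variety, and their differentials are linearly independent at
  every point of the chart, in particular at $A$. The differentials are transported to an arbitrary
  chart at $A$ through the space of $k \times n$ matrices.
\<close>

unbundle no vec_syntax

section \<open>Dimensions of subspaces\<close>

lemma subspaceI:
  assumes "W \<subseteq> carrier_vec n" "0\<^sub>v n \<in> W"
    and "\<And>v w. v \<in> W \<Longrightarrow> w \<in> W \<Longrightarrow> v + w \<in> W"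
    and "\<And>c v. v \<in> W \<Longrightarrow> c \<cdot>\<^sub>v v \<in> W"
  shows "VectorSpace.subspace class_ring W (cvs n)"
proof -
  interpret vec_space "TYPE(complex)" n .
  have m: "Module.module (class_ring :: complex ring) (cvs n)"
    using vectorspace_axioms unfolding vectorspace_def by blast
  show ?thesis unfolding subspace_def submodule_def
    using assms vectorspace_axioms m
    by (auto simp: module_vec_simps class_ring_simps)
qed

lemma subspaceD:
  assumes "VectorSpace.subspace class_ring W (cvs n)"
  shows "W \<subseteq> carrier_vec n" "0\<^sub>v n \<in> W"
    and "\<And>v w. v \<in> W \<Longrightarrow> w \<in> W \<Longrightarrow> v + w \<in> W"
    and "\<And>c v. v \<in> W \<Longrightarrow> c \<cdot>\<^sub>v v \<in> W"
  using assms unfolding subspace_def submodule_def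
  by (auto simp: module_vec_simps class_ring_simps)

lemma vectorspace_subspace:
  assumes "VectorSpace.subspace class_ring W (cvs n)"
  shows "vectorspace class_ring (cvs n\<lparr>carrier := W\<rparr>)"
proof -
  interpret vec_space "TYPE(complex)" n .
  show ?thesis by (rule subspace_is_vs[OF assms])
qed

text \<open>Independence of vectors of \<open>W\<close> does not depend on whether it is tested in
  \<open>W\<close> or in the ambient space, so an independent subset of \<open>W\<close> has at most
  \<open>n\<close> elements. One that is maximal under inclusion therefore exists, and it is a
  basis.\<close>

lemma fin_dim_subspace:
  assumes "VectorSpace.subspace class_ring W (cvs n)"
  shows "vectorspace.fin_dim class_ring (cvs n\<lparr>carrier := W\<rparr>)"
proof -
  interpret vec_space "TYPE(complex)" n .
  interpret W: vectorspace class_ring "cvs n\<lparr>carrier := W\<rparr>" by (rule vectorspace_subspace[OF assms])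
  have sub: "submodule class_ring W (cvs n)" using assms unfolding subspace_def by blast
  have WV: "W \<subseteq> carrier_vec n" using subspaceD(1)[OF assms] .
  have li: "W.lin_indpt B \<Longrightarrow> lin_indpt B" if "B \<subseteq> W" for B
    using span_li_not_depend(2)[OF that sub] by blast
  have bnd: "finite B \<and> card B \<le> n" if "B \<subseteq> W" "W.lin_indpt B" for B
    using li_le_dim[OF fin_dim _ li[OF that]] that WV dim_is_n by auto
  have "W.lin_indpt {}" by (auto simp: W.lin_dep_def)
  then obtain B where B: "finite B" "maximal B (\<lambda>B. B \<subseteq> W \<and> W.lin_indpt B)"
    using maximal_exists[of "\<lambda>B. B \<subseteq> W \<and> W.lin_indpt B" n "{}"] bnd by auto
  have "W.basis B" using W.max_li_is_basis B by auto
  then show ?thesis unfolding W.fin_dim_def W.basis_def using B(1) by auto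
qed

lemma subspace_dim_mono:
  assumes U: "VectorSpace.subspace class_ring U (cvs n)"
    and W: "VectorSpace.subspace class_ring W (cvs n)" and "U \<subseteq> W"
  shows "subspace_dim n U \<le> subspace_dim n W"
proof -
  interpret W: vectorspace class_ring "cvs n\<lparr>carrier := W\<rparr>" by (rule vectorspace_subspace[OF W])
  have "VectorSpace.subspace class_ring U (cvs n\<lparr>carrier := W\<rparr>)"
    using W.vectorspace_axioms W.module_axioms subspaceD[OF U] assms(3)
    unfolding subspace_def submodule_def by (auto simp: module_vec_simps class_ring_simps)
  from W.subspace_dim[OF this fin_dim_subspace[OF W]] fin_dim_subspace[OF U]
  show ?thesis by (simp add: subspace_dim_def)
qed

lemma subspace_dim_carrier: "subspace_dim n (carrier_vec n) = n"
proof -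
  interpret vec_space "TYPE(complex)" n .
  have eq: "cvs n\<lparr>carrier := carrier_vec n\<rparr> = cvs n" by (simp add: module_vec_def)
  show ?thesis unfolding subspace_dim_def eq by (rule dim_is_n)
qed

lemma subspace_dim_pos:
  assumes W: "VectorSpace.subspace class_ring W (cvs n)" and "v \<in> W" "v \<noteq> 0\<^sub>v n"
  shows "0 < subspace_dim n W"
proof -
  interpret W: vectorspace class_ring "cvs n\<lparr>carrier := W\<rparr>" by (rule vectorspace_subspace[OF W])
  have "W.lin_indpt {v}"
  proof (rule W.finite_lin_indpt2)
    fix a assume "a \<in> {v} \<rightarrow> carrier (class_ring :: complex ring)" 
      "W.lincomb a {v} = \<zero>\<^bsub>cvs n\<lparr>carrier := W\<rparr>\<^esub>"
    then have "a v \<cdot>\<^sub>v v = 0\<^sub>v n"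
      using assms subspaceD[OF W]
      by (auto simp: W.lincomb_def module_vec_simps class_ring_simps)
    moreover obtain i where "i < n" "v $ i \<noteq> 0"
      using assms subspaceD(1)[OF W] by (metis carrier_vecD eq_vecI index_zero_vec subsetD)
    ultimately have "a v = 0"
      using assms subspaceD(1)[OF W] by (metis carrier_vecD index_smult_vec(1) index_zero_vec(1) mult_eq_0_iff subsetD)
    then show "\<forall>w\<in>{v}. a w = \<zero>\<^bsub>class_ring\<^esub>" by (simp add: class_ring_simps)
  qed (use assms in auto)
  then show ?thesis using W.li_le_dim[OF fin_dim_subspace[OF W], of "{v}"] assms
    by (simp add: subspace_dim_def)
qed

text \<open>Rank-nullity for a bare function that is linear only on \<open>W\<close>. Truncations of
  vectors and tuples of functionals can then be used directly, with kernel and image as subspaces of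
  the full coordinate spaces.\<close>

lemma linear_rank_nullity:
  assumes W: "VectorSpace.subspace class_ring W (cvs n)"
    and f: "\<And>v. v \<in> W \<Longrightarrow> f v \<in> carrier_vec m"
    and add: "\<And>v w. v \<in> W \<Longrightarrow> w \<in> W \<Longrightarrow> f (v + w) = f v + f w"
    and smult: "\<And>c v. v \<in> W \<Longrightarrow> f (c \<cdot>\<^sub>v v) = c \<cdot>\<^sub>v f v"
  shows "subspace_dim m (f ` W) + subspace_dim n {v \<in> W. f v = 0\<^sub>v m} = subspace_dim n W"
    and "VectorSpace.subspace class_ring {v \<in> W. f v = 0\<^sub>v m} (cvs n)"
    and "VectorSpace.subspace class_ring (f ` W) (cvs m)"
proof -
  interpret vec_space "TYPE(complex)" m .
  interpret W: vectorspace class_ring "cvs n\<lparr>carrier := W\<rparr>" by (rule vectorspace_subspace[OF W])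
  interpret L: linear_map class_ring "cvs n\<lparr>carrier := W\<rparr>" "cvs m" f
    by (unfold_locales) (use f add smult in \<open>auto simp: module_hom_def module_vec_simps class_ring_simps\<close>)
  have k: "L.kerT = {v \<in> W. f v = 0\<^sub>v m}" "L.imT = f ` W"
    unfolding L.ker_def L.im_def by (auto simp: module_vec_simps)
  from L.rank_nullity[OF fin_dim_subspace[OF W]]
  show "subspace_dim m (f ` W) + subspace_dim n {v \<in> W. f v = 0\<^sub>v m} = subspace_dim n W"
    unfolding k by (simp add: subspace_dim_def)
  show "VectorSpace.subspace class_ring (f ` W) (cvs m)"
    using L.imT_is_subspace unfolding k .
  \<comment> \<open>The kernel is first obtained as a subspace of \<open>W\<close>; the closure
    properties then carry over to the ambient space.\<close>
  note ks = L.kerT_is_subspace[unfolded k]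
  show "VectorSpace.subspace class_ring {v \<in> W. f v = 0\<^sub>v m} (cvs n)"
    using ks subspaceD[OF W] unfolding subspace_def submodule_def
    by (intro subspaceI[unfolded subspace_def submodule_def]) (auto simp: module_vec_simps class_ring_simps)
qed

section \<open>Polynomial functions and minors\<close>

lemma poly_funs_sum:
  "(\<And>i. i \<in> A \<Longrightarrow> f i \<in> poly_funs S) \<Longrightarrow> (\<lambda>x. \<Sum>i\<in>A. f i x) \<in> poly_funs S"
  by (induction A rule: infinite_finite_induct) (auto intro: poly_funs.intros)

lemma poly_funs_prod:
  "(\<And>i. i \<in> A \<Longrightarrow> f i \<in> poly_funs S) \<Longrightarrow> (\<lambda>x. \<Prod>i\<in>A. f i x) \<in> poly_funs S"
  by (induction A rule: infinite_finite_induct) (auto intro: poly_funs.intros)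

lemma poly_funs_subst:
  assumes "f \<in> poly_funs S" and "\<And>s. s \<in> S \<Longrightarrow> (\<lambda>x. h x s) \<in> poly_funs S'"
  shows "(\<lambda>x. f (h x)) \<in> poly_funs S'"
  using assms by induction (auto intro: poly_funs.intros)

lemma poly_funs_field_differentiable:
  assumes "f \<in> poly_funs S"
  shows "(\<lambda>t. f (x(s := t))) field_differentiable (at z)"
  using assms
proof induction
  case (var s')
  show ?case by (cases "s' = s") (auto intro: field_differentiable_const field_differentiable_ident)
qed (auto intro: derivative_intros field_differentiable_add field_differentiable_mult)

text \<open>Chain rule along a line, by induction on the construction of the polynomial: both sides
  obey the same sum and product rules. Differentials of minors can thus be found by restricting
  minors to lines.\<close>

lemma poly_funs_directional_derivative:
  assumes "f \<in> poly_funs S" "finite S"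
  shows "((\<lambda>t. f (\<lambda>s. x s + t * \<xi> s)) has_field_derivative
    (\<Sum>s\<in>S. partial_deriv s f x * \<xi> s)) (at 0)"
  using assms
proof induction
  case (const c)
  have "partial_deriv s (\<lambda>_. c) x = 0" for s by (simp add: partial_deriv_def)
  then show ?case by simp
next
  case (var s)
  have "partial_deriv s' (\<lambda>x. x s) x = (if s' = s then 1 else 0)" for s'
    by (auto simp: partial_deriv_def)
  then have "(\<Sum>s'\<in>S. partial_deriv s' (\<lambda>x. x s) x * \<xi> s') = \<xi> s"
    using var by (simp add: if_distrib[of "\<lambda>a. a * _"] cong: if_cong)
  then show ?case by (auto intro!: derivative_eq_intros)
next
  case (add f g)
  have "partial_deriv s (\<lambda>x. f x + g x) x = partial_deriv s f x + partial_deriv s g x" for s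
    unfolding partial_deriv_def
    by (intro deriv_add poly_funs_field_differentiable[OF add.hyps(1)]
        poly_funs_field_differentiable[OF add.hyps(2)])
  with DERIV_add[OF add.IH(1)[OF add.prems] add.IH(2)[OF add.prems]] show ?case
    by (simp add: sum.distrib distrib_right)
next
  case (mult f g)
  have "partial_deriv s (\<lambda>x. f x * g x) x = f x * partial_deriv s g x + partial_deriv s f x * g x" for s
    unfolding partial_deriv_def
    using deriv_mult[OF poly_funs_field_differentiable[OF mult.hyps(1), of x s "x s"]
        poly_funs_field_differentiable[OF mult.hyps(2), of x s "x s"]] by simp
  with DERIV_mult[OF mult.IH(1)[OF mult.prems] mult.IH(2)[OF mult.prems]] show ?case
    by (simp add: sum.distrib sum_distrib_left sum_distrib_right algebra_simps)
qed

section \<open>Column sets and maximal minors\<close>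

lemma ksubsetsD:
  assumes "I \<in> ksubsets n k"
  shows "finite I" "I \<subseteq> {..<n}" "card I = k" "{j. j < n \<and> j \<in> I} = I"
  using assms finite_subset unfolding ksubsets_def by auto

lemma bij_betw_pick:
  assumes "I \<in> ksubsets n k"
  shows "bij_betw (pick I) {..<k} I"
proof -
  note I = ksubsetsD[OF assms]
  have "inj_on (pick I) {..<k}"
    by (rule linorder_inj_onI') (use pick_mono[of _ I] I(3) in fastforce)
  moreover have "pick I ` {..<k} \<subseteq> I" using pick_in_set[of _ I] I(3) by auto
  ultimately show ?thesis
    using I by (simp add: bij_betw_def card_image card_subset_eq)
qed

lemma submatrix_columns:
  assumes "M \<in> carrier_mat k n" "I \<in> ksubsets n k"
  shows "submatrix M UNIV I = mat k k (\<lambda>(i, j). M $$ (i, pick I j))"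
  using assms ksubsetsD[OF assms(2)] by (auto simp: submatrix_def pick_UNIV)

lemma pick_less:
  assumes "I \<in> ksubsets n k" "j < k"
  shows "pick I j < n" "pick I j \<in> I"
  using bij_betw_pick[OF assms(1)] ksubsetsD(2)[OF assms(1)] assms(2)
  unfolding bij_betw_def by auto

text \<open>Leibniz expansion. The variables are the matrix entries themselves, so the minor is a
  polynomial on all \<open>k\<close> by \<open>n\<close> matrices, independently of any
  chart.\<close>

lemma minor_cols_poly_funs:
  assumes "I \<in> ksubsets n k"
  shows "(\<lambda>m. minor_cols I (mat k n m)) \<in> poly_funs ({..<k} \<times> {..<n})"
proof -
  have eq: "(\<lambda>m. minor_cols I (mat k n m)) =
    (\<lambda>m. \<Sum>p\<in>{p. p permutes {0..<k}}. signof p * (\<Prod>i\<in>{0..<k}. m (i, pick I (p i))))"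
  proof
    fix m :: "nat \<times> nat \<Rightarrow> complex"
    have "submatrix (mat k n m) UNIV I = mat k k (\<lambda>(i, j). m (i, pick I j))"
      using pick_less(1)[OF assms] by (auto simp: submatrix_columns[OF _ assms])
    moreover have "p i < k" if "p permutes {0..<k}" "i < k" for p i
      using permutes_in_image[OF that(1), of i] that(2) by simp
    ultimately show "minor_cols I (mat k n m) =
      (\<Sum>p\<in>{p. p permutes {0..<k}}. signof p * (\<Prod>i\<in>{0..<k}. m (i, pick I (p i))))"
      unfolding minor_cols_def
      by (subst det_def'[of _ k]) (auto intro!: sum.cong prod.cong)
  qed
  show ?thesis unfolding eq
    by (intro poly_funs_sum poly_funs.mult poly_funs.const poly_funs_prod poly_funs.var)
      (auto simp: pick_less[OF assms] permutes_in_image)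
qed

lemma minor_cols_cong:
  assumes "M \<in> carrier_mat k n" "M' \<in> carrier_mat k n" "I \<in> ksubsets n k"
    and "\<And>i j. i < k \<Longrightarrow> j \<in> I \<Longrightarrow> M $$ (i, j) = M' $$ (i, j)"
  shows "minor_cols I M = minor_cols I M'"
proof -
  have "submatrix M UNIV I = submatrix M' UNIV I"
    unfolding submatrix_columns[OF assms(1,3)] submatrix_columns[OF assms(2,3)]
    using assms(4) pick_less[OF assms(3)] by auto
  then show ?thesis by (simp add: minor_cols_def)
qed

text \<open>Column selection commutes with left multiplication, so a change of basis of the row span
  scales every maximal minor by the same determinant.\<close>

lemma minor_cols_mult:
  assumes "G \<in> carrier_mat k k" "M \<in> carrier_mat k n" "I \<in> ksubsets n k"
  shows "minor_cols I (G * M) = det G * minor_cols I M"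
proof -
  have "submatrix (G * M) UNIV I = G * submatrix M UNIV I"
    unfolding submatrix_columns[OF mult_carrier_mat[OF assms(1,2)] assms(3)]
      submatrix_columns[OF assms(2,3)]
    using assms pick_less[OF assms(3)] by (auto simp: scalar_prod_def)
  then show ?thesis unfolding minor_cols_def
    using det_mult[OF assms(1), of "submatrix M UNIV I"] by (simp add: submatrix_columns[OF assms(2,3)])
qed

text \<open>Because \<open>R\<close> is supported in the rows \<open>I\<close>, the product
  \<open>M * R\<close> involves only the columns \<open>I\<close> of \<open>M\<close>. The identity
  matrix thus factors through the square submatrix, whose determinant must be a unit.\<close>

lemma minor_cols_nonzeroI:
  assumes M: "M \<in> carrier_mat k n" and R: "R \<in> carrier_mat n k" and I: "I \<in> ksubsets n k"
    and MR: "M * R = 1\<^sub>m k"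
    and supp: "\<And>i j. i < n \<Longrightarrow> j < k \<Longrightarrow> i \<notin> I \<Longrightarrow> R $$ (i, j) = 0"
  shows "minor_cols I M \<noteq> 0"
proof -
  define Q where "Q = mat k k (\<lambda>(i, j). R $$ (pick I i, j))"
  have Q: "Q \<in> carrier_mat k k" by (simp add: Q_def)
  have "submatrix M UNIV I * Q = M * R"
  proof (rule eq_matI)
    fix i j assume ij: "i < dim_row (M * R)" "j < dim_col (M * R)"
    then have "(M * R) $$ (i, j) = (\<Sum>l\<in>{..<n}. M $$ (i, l) * R $$ (l, j))"
      using M R by (auto simp: scalar_prod_def lessThan_atLeast0 intro!: sum.cong)
    also have "\<dots> = (\<Sum>l\<in>I. M $$ (i, l) * R $$ (l, j))"
      using ksubsetsD[OF I] supp ij R by (intro sum.mono_neutral_right) auto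
    also have "\<dots> = (\<Sum>l\<in>{..<k}. M $$ (i, pick I l) * R $$ (pick I l, j))"
      by (rule sum.reindex_bij_betw[OF bij_betw_pick[OF I], symmetric])
    finally show "(submatrix M UNIV I * Q) $$ (i, j) = (M * R) $$ (i, j)"
      using M R ij by (simp add: submatrix_columns[OF M I] Q_def scalar_prod_def lessThan_atLeast0)
  qed (use M R in \<open>auto simp: submatrix_columns[OF M I] Q_def\<close>)
  then have "det (submatrix M UNIV I) * det Q = 1"
    using det_mult[OF _ Q, of "submatrix M UNIV I"] by (simp add: submatrix_columns[OF M I] MR)
  then show ?thesis by (auto simp: minor_cols_def)
qed

section \<open>Exchange minors and chart coordinates\<close>

text \<open>The removed element is given by its position \<open>a\<close> in \<open>J\<close>: in
  the chart of \<open>J\<close>, the column \<open>pick J a\<close> is the unit vector of row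
  \<open>a\<close>, so the pair \<open>(a, b)\<close> names both an exchange and a matrix
  entry.\<close>

definition exchange :: "nat set \<Rightarrow> nat \<Rightarrow> nat \<Rightarrow> nat set" where
  "exchange J a b = insert b (J - {pick J a})"

lemma pick_eq_iff:
  assumes "J \<in> ksubsets n k" "i < k" "j < k"
  shows "pick J i = pick J j \<longleftrightarrow> i = j"
  using bij_betw_pick[OF assms(1)] assms(2,3) unfolding bij_betw_def inj_on_def by auto

lemma ksubsets_pickE:
  assumes "J \<in> ksubsets n k" "l \<in> J"
  obtains i where "i < k" "l = pick J i"
  using bij_betw_pick[OF assms(1)] assms(2) unfolding bij_betw_def by auto

lemma exchange_ksubsets:
  assumes "J \<in> ksubsets n k" "a < k" "b < n" "b \<notin> J"
  shows "exchange J a b \<in> ksubsets n k"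
proof -
  note J = ksubsetsD[OF assms(1)]
  have "card (exchange J a b) = Suc (card (J - {pick J a}))"
    unfolding exchange_def using J assms(4) by simp
  also have "\<dots> = k" using J pick_less[OF assms(1,2)] assms(2) by simp
  finally show ?thesis using J assms(3) unfolding ksubsets_def exchange_def by auto
qed

text \<open>The columns concerned are those of the identity with column \<open>a\<close> replaced by
  column \<open>b\<close> of \<open>M\<close>, up to order. The sign of the reordering is not
  computed: it is the minor of one fixed model matrix \<open>U\<close>, and only its independence of
  \<open>M\<close> and its being nonzero matter.\<close>

lemma exchange_minor:
  assumes J: "J \<in> ksubsets n k" and a: "a < k" and b: "b < n" "b \<notin> J"
  obtains \<kappa> where "\<kappa> \<noteq> 0"
    "\<And>M. M \<in> carrier_mat k n \<Longrightarrow>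
      (\<And>i j. i < k \<Longrightarrow> j < k \<Longrightarrow> M $$ (i, pick J j) = (if i = j then 1 else 0)) \<Longrightarrow>
      minor_cols (exchange J a b) M = \<kappa> * M $$ (a, b)"
proof
  let ?I = "exchange J a b"
  have I: "?I \<in> ksubsets n k" by (rule exchange_ksubsets[OF assms])
  define U :: "complex mat" where
    "U = mat k n (\<lambda>(i, j). if j = b then (if i = a then 1 else 0) else if j = pick J i then 1 else 0)"
  \<comment> \<open>A right inverse of \<open>U\<close>: its columns are the unit vectors at the
    elements of the exchanged set, listed with \<open>b\<close> in place of \<open>pick J a\<close>.
    It witnesses that the minor of \<open>U\<close> is nonzero.\<close>
  define R :: "complex mat" where
    "R = mat n k (\<lambda>(l, c). if l = (if c = a then b else pick J c) then 1 else 0)"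
  have U: "U \<in> carrier_mat k n" and R: "R \<in> carrier_mat n k" by (simp_all add: U_def R_def)
  show "minor_cols ?I U \<noteq> 0"
  proof (rule minor_cols_nonzeroI[OF U R I])
    show "U * R = 1\<^sub>m k"
    proof (rule eq_matI)
      fix i j assume ij: "i < dim_row (1\<^sub>m k)" "j < dim_col (1\<^sub>m k)"
      let ?l = "if j = a then b else pick J j"
      have "(U * R) $$ (i, j) = (\<Sum>l\<in>{0..<n}. U $$ (i, l) * R $$ (l, j))"
        using U R ij by (auto simp: scalar_prod_def intro!: sum.cong)
      also have "\<dots> = (\<Sum>l\<in>{0..<n}. if l = ?l then U $$ (i, l) else 0)"
        using ij by (intro sum.cong) (auto simp: R_def)
      also have "\<dots> = U $$ (i, ?l)" using ij b pick_less[OF J] by simp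
      also have "\<dots> = (if i = j then 1 else 0)"
        using ij a b pick_less[OF J] pick_eq_iff[OF J] by (auto simp: U_def)
      finally show "(U * R) $$ (i, j) = 1\<^sub>m k $$ (i, j)" using ij by simp
    qed (use U R in auto)
    fix i j assume "i < n" "j < k" "i \<notin> ?I"
    then show "R $$ (i, j) = 0"
      using pick_less[OF J] pick_eq_iff[OF J _ a] by (auto simp: R_def exchange_def)
  qed
  fix M :: "complex mat" assume M: "M \<in> carrier_mat k n"
    and MJ: "\<And>i j. i < k \<Longrightarrow> j < k \<Longrightarrow> M $$ (i, pick J j) = (if i = j then 1 else 0)"
  \<comment> \<open>By Cramer's rule \<open>det G\<close> is the entry \<open>(a, b)\<close> of
    \<open>M\<close>. On the exchanged set \<open>G * U\<close> agrees with \<open>M\<close>: column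
    \<open>b\<close> of \<open>U\<close> picks out column \<open>a\<close> of \<open>G\<close>,
    which is column \<open>b\<close> of \<open>M\<close>, and the other columns pick out unit
    vectors.\<close>
  define G where "G = replace_col (1\<^sub>m k) (col M b) a"
  have cM: "col M b \<in> carrier_vec k" using M col_dim[of M b] by simp
  have G: "G \<in> carrier_mat k k" by (simp add: G_def replace_col_def)
  have "col M b $ a = M $$ (a, b)" using a b M by simp
  then have "det G = M $$ (a, b)"
    using cramer_lemma_mat[OF one_carrier_mat cM a]
    unfolding G_def one_mult_mat_vec[OF cM] det_one by simp
  moreover have "minor_cols ?I M = minor_cols ?I (G * U)"
  proof (rule minor_cols_cong[OF M mult_carrier_mat[OF G U] I])
    fix i j assume i: "i < k" and j: "j \<in> ?I"
    have jn: "j < n" using j ksubsetsD(2)[OF I] by auto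
    have GU: "(G * U) $$ (i, j) = (\<Sum>l\<in>{0..<k}. G $$ (i, l) * U $$ (l, j))"
      using G U i jn by (auto simp: scalar_prod_def intro!: sum.cong)
    show "M $$ (i, j) = (G * U) $$ (i, j)"
    proof (cases "j = b")
      case True
      have "(G * U) $$ (i, j) = (\<Sum>l\<in>{0..<k}. if l = a then G $$ (i, l) else 0)"
        unfolding GU using True b by (intro sum.cong) (auto simp: U_def)
      then show ?thesis using a i b M True by (simp add: G_def replace_col_def)
    next
      case False
      then obtain c where c: "c < k" "j = pick J c" "c \<noteq> a"
        using j ksubsets_pickE[OF J, of j] by (auto simp: exchange_def)
      have "(G * U) $$ (i, j) = (\<Sum>l\<in>{0..<k}. if l = c then G $$ (i, l) else 0)"
        unfolding GU using False jn c pick_eq_iff[OF J]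
        by (intro sum.cong) (auto simp: U_def)
      then show ?thesis using c i by (simp add: G_def replace_col_def MJ)
    qed
  qed
  ultimately show "minor_cols ?I M = minor_cols ?I U * M $$ (a, b)"
    by (simp add: minor_cols_mult[OF G U I])
qed

lemma minor_cols_zero_col:
  assumes M: "M \<in> carrier_mat k n" and I: "I \<in> ksubsets n k" and "j \<in> I"
    and "\<And>i. i < k \<Longrightarrow> M $$ (i, j) = 0"
  shows "minor_cols I M = 0"
proof -
  let ?H = "submatrix M UNIV I"
  have H: "?H \<in> carrier_mat k k" by (simp add: submatrix_columns[OF M I])
  obtain p where p: "p < k" "j = pick I p" using ksubsets_pickE[OF I \<open>j \<in> I\<close>] .
  have "?H *\<^sub>v unit_vec k p = 0\<^sub>v k"
    using p assms(4) by (auto simp: submatrix_columns[OF M I] scalar_prod_def if_distrib cong: if_cong)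
  then show ?thesis unfolding minor_cols_def det_0_iff_vec_prod_zero_field[OF H]
    using p unit_vec_nonzero[of k p] by (intro exI[of _ "unit_vec k p"]) auto
qed

lemma minor_cols_zero_row:
  assumes M: "M \<in> carrier_mat k n" and I: "I \<in> ksubsets n k" and "i < k"
    and "\<And>j. j \<in> I \<Longrightarrow> M $$ (i, j) = 0"
  shows "minor_cols I M = 0"
proof -
  let ?H = "submatrix M UNIV I"
  have H: "?H \<in> carrier_mat k k" by (simp add: submatrix_columns[OF M I])
  have "?H\<^sup>T *\<^sub>v unit_vec k i = 0\<^sub>v k"
    using assms(3,4) pick_less[OF I]
    by (auto simp: submatrix_columns[OF M I] scalar_prod_def if_distrib cong: if_cong)
  then have "det ?H\<^sup>T = 0" unfolding det_0_iff_vec_prod_zero_field[OF transpose_carrier_mat[THEN iffD2, OF H]]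
    using assms(3) unit_vec_nonzero[of k i] by (intro exI[of _ "unit_vec k i"]) auto
  then show ?thesis unfolding minor_cols_def by (simp add: det_transpose[OF H])
qed

section \<open>Numbering of the chart coordinates\<close>

definition coord_index :: "nat \<Rightarrow> nat \<Rightarrow> nat set \<Rightarrow> nat \<Rightarrow> nat \<Rightarrow> nat" where
  "coord_index n k J a b = a * (n - k) + card {c. c < b \<and> c \<notin> J}"

definition coord_row :: "nat \<Rightarrow> nat \<Rightarrow> nat \<Rightarrow> nat" where
  "coord_row n k q = q div (n - k)"

text \<open>The complement is taken in all natural numbers; its first \<open>n - k\<close> elements
  are the columns below \<open>n\<close> outside \<open>J\<close>, and the remainder modulo
  \<open>n - k\<close> stays within these.\<close>

definition coord_col :: "nat \<Rightarrow> nat \<Rightarrow> nat set \<Rightarrow> nat \<Rightarrow> nat" where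
  "coord_col n k J q = pick (- J) (q mod (n - k))"

lemma card_complement:
  assumes "J \<in> ksubsets n k"
  shows "card {c. c < n \<and> c \<notin> J} = n - k"
proof -
  have "{c. c < n \<and> c \<notin> J} = {..<n} - J" by auto
  then show ?thesis using ksubsetsD[OF assms] by (simp add: card_Diff_subset)
qed

lemma coord_index_props:
  assumes J: "J \<in> ksubsets n k" and a: "a < k" and b: "b < n" "b \<notin> J"
  shows "coord_index n k J a b < k * (n - k)"
    "coord_row n k (coord_index n k J a b) = a" "coord_col n k J (coord_index n k J a b) = b"
proof -
  \<comment> \<open>The inclusion is strict because \<open>b\<close> is missing on the left. The
    column part of the index is therefore below \<open>n - k\<close>, so division with remainder
    recovers row and column.\<close>
  have "{c. c < b \<and> c \<notin> J} \<subset> {c. c < n \<and> c \<notin> J}" using b by auto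
  then have lt: "card {c. c < b \<and> c \<notin> J} < n - k"
    using card_complement[OF J] psubset_card_mono[of "{c. c < n \<and> c \<notin> J}"] by auto
  have "coord_index n k J a b < a * (n - k) + (n - k)" using lt by (simp add: coord_index_def)
  also have "\<dots> \<le> k * (n - k)" using a by (metis Suc_leI add.commute mult_Suc mult_le_mono1)
  finally show "coord_index n k J a b < k * (n - k)" .
  show "coord_row n k (coord_index n k J a b) = a"
    using lt by (simp add: coord_index_def coord_row_def)
  have "{c. c < b \<and> c \<notin> J} = {c \<in> - J. c < b}" by auto
  then show "coord_col n k J (coord_index n k J a b) = b"
    using lt pick_card_in_set[of b "- J"] b by (simp add: coord_index_def coord_col_def)
qed

lemma coord_props:
  assumes J: "J \<in> ksubsets n k" and q: "q < k * (n - k)"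
  shows "coord_row n k q < k" "coord_col n k J q < n" "coord_col n k J q \<notin> J"
    "coord_index n k J (coord_row n k q) (coord_col n k J q) = q"
proof -
  have pos: "0 < n - k" using q by (cases "n - k") auto
  show "coord_row n k q < k" using q by (simp add: coord_row_def less_mult_imp_div_less)
  have inf: "infinite (- J)" using ksubsetsD(1)[OF J] by (simp add: Compl_eq_Diff_UNIV)
  have lt: "q mod (n - k) < card {c. c < n \<and> c \<in> - J}"
    using card_complement[OF J] pos by simp
  show "coord_col n k J q < n" unfolding coord_col_def by (rule pick_le[OF lt])
  show "coord_col n k J q \<notin> J" unfolding coord_col_def using pick_in_set_inf[OF inf] by auto
  have "{c. c < coord_col n k J q \<and> c \<notin> J} = {c \<in> - J. c < coord_col n k J q}" by auto
  then show "coord_index n k J (coord_row n k q) (coord_col n k J q) = q"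
    unfolding coord_index_def coord_row_def
    using card_pick_inf[OF inf, of "q mod (n - k)"] div_mult_mod_eq[of q "n - k"]
    by (simp add: coord_col_def)
qed

section \<open>Chart matrices and differentials of minors\<close>

lemma chart_mat_carrier [simp]: "chart_mat n k J x \<in> carrier_mat k n"
  by (simp add: chart_mat_def)

lemma dim_chart_mat [simp]: "dim_row (chart_mat n k J x) = k" "dim_col (chart_mat n k J x) = n"
  by (simp_all add: chart_mat_def)

lemma chart_mat_pick:
  assumes "J \<in> ksubsets n k" "i < k" "j < k"
  shows "chart_mat n k J x $$ (i, pick J j) = (if i = j then 1 else 0)"
  using pick_less[OF assms(1,3)] pick_eq_iff[OF assms(1,3,2)] assms by (auto simp: chart_mat_def)

lemma chart_mat_coord:
  assumes "a < k" "b < n" "b \<notin> J"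
  shows "chart_mat n k J x $$ (a, b) = x (coord_index n k J a b)"
  using assms by (simp add: chart_mat_def coord_index_def)

lemma chart_mat_in_J:
  assumes "a < k" "b < n" "b \<in> J"
  shows "chart_mat n k J x $$ (a, b) = (if b = pick J a then 1 else 0)"
  using assms by (simp add: chart_mat_def)

text \<open>The differential of the minor at \<open>M\<close> in the direction \<open>P\<close>,
  taken on the space of all matrices. This is the common ground on which different charts are
  compared.\<close>

definition minor_deriv :: "nat \<Rightarrow> nat \<Rightarrow> nat set \<Rightarrow> complex mat \<Rightarrow> complex mat \<Rightarrow> complex" where
  "minor_deriv k n I M P = (\<Sum>s\<in>{..<k} \<times> {..<n}.
     partial_deriv s (\<lambda>m. minor_cols I (mat k n m)) (\<lambda>s. M $$ s) * P $$ s)"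

lemma minor_deriv:
  assumes I: "I \<in> ksubsets n k" and M: "M \<in> carrier_mat k n" and P: "P \<in> carrier_mat k n"
  shows "((\<lambda>t. minor_cols I (M + t \<cdot>\<^sub>m P)) has_field_derivative minor_deriv k n I M P) (at 0)"
proof -
  have "mat k n (\<lambda>s. M $$ s + t * P $$ s) = M + t \<cdot>\<^sub>m P" for t
    using M P by (intro eq_matI) auto
  then show ?thesis
    using poly_funs_directional_derivative[OF minor_cols_poly_funs[OF I], of "\<lambda>s. M $$ s" "\<lambda>s. P $$ s"]
    by (simp add: minor_deriv_def)
qed

lemma minor_deriv_minus:
  assumes "P \<in> carrier_mat k n" "Q \<in> carrier_mat k n"
  shows "minor_deriv k n I M (P - Q) = minor_deriv k n I M P - minor_deriv k n I M Q"
  unfolding minor_deriv_def sum_subtractf[symmetric]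
  using assms by (intro sum.cong) (auto simp: algebra_simps)

text \<open>The line \<open>M + t X M\<close> equals \<open>(1 + t X) M\<close>, along which the
  minor is multiplied by a determinant. Being zero at \<open>M\<close>, it is zero on the whole
  line.\<close>

lemma minor_deriv_orbit:
  assumes I: "I \<in> ksubsets n k" and M: "M \<in> carrier_mat k n" and X: "X \<in> carrier_mat k k"
    and "minor_cols I M = 0"
  shows "minor_deriv k n I M (X * M) = 0"
proof -
  have "minor_cols I (M + t \<cdot>\<^sub>m (X * M)) = 0" for t
  proof -
    have "(1\<^sub>m k + t \<cdot>\<^sub>m X) * M = M + t \<cdot>\<^sub>m (X * M)"
      using M X by (simp add: add_mult_distrib_mat[of _ k k] mult_smult_assoc_mat[OF X M])
    then show ?thesis
      using minor_cols_mult[of "1\<^sub>m k + t \<cdot>\<^sub>m X" k M n I] M X I assms(4) by simp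
  qed
  then show ?thesis using DERIV_unique[OF minor_deriv[OF I M mult_carrier_mat[OF X M]]] by simp
qed

lemma minor_chart_poly_funs:
  assumes I: "I \<in> ksubsets n k" and J: "J \<in> ksubsets n k"
  shows "(\<lambda>x. minor_cols I (chart_mat n k J x)) \<in> poly_funs {..<k * (n - k)}"
proof -
  have "chart_mat n k J x = mat k n (\<lambda>s. chart_mat n k J x $$ s)" for x
    by (intro eq_matI) auto
  moreover have "(\<lambda>x. minor_cols I (mat k n (\<lambda>s. chart_mat n k J x $$ s))) \<in> poly_funs {..<k * (n - k)}"
  proof (rule poly_funs_subst[OF minor_cols_poly_funs[OF I]])
    fix s assume "s \<in> {..<k} \<times> {..<n}"
    then obtain a b where s: "s = (a, b)" "a < k" "b < n" by auto
    show "(\<lambda>x. chart_mat n k J x $$ s) \<in> poly_funs {..<k * (n - k)}"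
      using s coord_index_props(1)[OF J, of a b]
      by (cases "b \<in> J") (auto simp: chart_mat_in_J chart_mat_coord intro: poly_funs.intros)
  qed
  ultimately show ?thesis by simp
qed

text \<open>A direction \<open>P\<close> that vanishes in the columns \<open>J\<close> keeps the
  identity block fixed, so moving along \<open>P\<close> only shifts the chart coordinates by
  multiples of the entries of \<open>P\<close>. The two derivatives belong to the same function of
  \<open>t\<close>.\<close>

lemma minor_chart_deriv:
  assumes I: "I \<in> ksubsets n k" and J: "J \<in> ksubsets n k" and P: "P \<in> carrier_mat k n"
    and PJ: "\<And>i j. i < k \<Longrightarrow> j \<in> J \<Longrightarrow> P $$ (i, j) = 0"
  shows "(\<Sum>q<k * (n - k). partial_deriv q (\<lambda>x. minor_cols I (chart_mat n k J x)) x *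
      P $$ (coord_row n k q, coord_col n k J q)) = minor_deriv k n I (chart_mat n k J x) P"
proof -
  have "chart_mat n k J (\<lambda>q. x q + t * P $$ (coord_row n k q, coord_col n k J q)) =
      chart_mat n k J x + t \<cdot>\<^sub>m P" for t
  proof (rule eq_matI)
    fix a b assume "a < dim_row (chart_mat n k J x + t \<cdot>\<^sub>m P)" "b < dim_col (chart_mat n k J x + t \<cdot>\<^sub>m P)"
    then have ab: "a < k" "b < n" using P by auto
    then show "chart_mat n k J (\<lambda>q. x q + t * P $$ (coord_row n k q, coord_col n k J q)) $$ (a, b) =
      (chart_mat n k J x + t \<cdot>\<^sub>m P) $$ (a, b)"
      using P PJ coord_index_props[OF J ab]
      by (cases "b \<in> J") (auto simp: chart_mat_in_J chart_mat_coord)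
  qed (use P in auto)
  then show ?thesis
    using poly_funs_directional_derivative[OF minor_chart_poly_funs[OF I J], of x
        "\<lambda>q. P $$ (coord_row n k q, coord_col n k J q)"]
      minor_deriv[OF I chart_mat_carrier P, of J x] by (auto intro: DERIV_unique)
qed

section \<open>Rank, codimension and Schubert conditions\<close>

text \<open>The vectors \<open>\<xi>\<close> are dual to the functionals \<open>c\<close> up to
  nonzero scalars, so evaluating all functionals maps onto a space of dimension
  \<open>card S\<close>. Its kernel contains \<open>T\<close>, and rank-nullity bounds the dimension
  of \<open>T\<close>.\<close>

lemma codim_ge_functionals:
  fixes c :: "'s \<Rightarrow> nat \<Rightarrow> complex" and \<xi> :: "'s \<Rightarrow> complex vec"
  assumes T: "VectorSpace.subspace class_ring T (cvs N)" and S: "finite S"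
    and zero: "\<And>s \<tau>. s \<in> S \<Longrightarrow> \<tau> \<in> T \<Longrightarrow> (\<Sum>q<N. c s q * \<tau> $ q) = 0"
    and dual: "\<And>s s'. s \<in> S \<Longrightarrow> s' \<in> S \<Longrightarrow> (\<Sum>q<N. c s q * \<xi> s' $ q) = (if s = s' then \<mu> s else 0)"
    and nz: "\<And>s. s \<in> S \<Longrightarrow> \<mu> s \<noteq> 0"
  shows "card S + subspace_dim N T \<le> N"
proof -
  define r where "r = card S"
  obtain e where e: "bij_betw e {0..<r} S"
    using ex_bij_betw_nat_finite[OF S] unfolding r_def by blast
  have eS: "e i \<in> S" if "i < r" for i using bij_betwE[OF e] that by auto
  have e_eq: "e i = e j \<longleftrightarrow> i = j" if "i < r" "j < r" for i j
    using e that unfolding bij_betw_def inj_on_def by auto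
  define f where "f v = vec r (\<lambda>i. \<Sum>q<N. c (e i) q * v $ q)" for v :: "complex vec"
  have V: "VectorSpace.subspace class_ring (carrier_vec N) (cvs N)" by (rule subspaceI) auto
  have "f ` carrier_vec N = carrier_vec r"
  proof (intro equalityI subsetI)
    fix w :: "complex vec" assume w: "w \<in> carrier_vec r"
    \<comment> \<open>The preimage of \<open>w\<close> is read off from duality, dividing out the
      scalars \<open>\<mu>\<close>.\<close>
    define v where "v = vec N (\<lambda>q. \<Sum>j<r. w $ j / \<mu> (e j) * \<xi> (e j) $ q)"
    have "(\<Sum>q<N. c (e i) q * v $ q) = w $ i" if i: "i < r" for i
    proof -
      have "(\<Sum>q<N. c (e i) q * v $ q) =
          (\<Sum>q<N. \<Sum>j<r. w $ j / \<mu> (e j) * (c (e i) q * \<xi> (e j) $ q))"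
        by (simp add: v_def sum_distrib_left algebra_simps)
      also have "\<dots> = (\<Sum>j<r. w $ j / \<mu> (e j) * (\<Sum>q<N. c (e i) q * \<xi> (e j) $ q))"
        unfolding sum_distrib_left by (rule sum.swap)
      also have "\<dots> = (\<Sum>j<r. if j = i then w $ i else 0)"
        using i by (intro sum.cong) (auto simp: dual eS e_eq nz)
      finally show ?thesis using i by simp
    qed
    then have "f v = w" using w by (auto simp: f_def)
    then show "w \<in> f ` carrier_vec N" by (force simp: v_def)
  qed (auto simp: f_def)
  moreover have "f (v + w) = f v + f w" if "v \<in> carrier_vec N" "w \<in> carrier_vec N" for v w
    using that by (auto simp: f_def sum.distrib distrib_left intro!: eq_vecI)
  moreover have "f (a \<cdot>\<^sub>v v) = a \<cdot>\<^sub>v f v" if "v \<in> carrier_vec N" for a v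
    using that by (auto simp: f_def sum_distrib_left mult.left_commute intro!: eq_vecI)
  moreover have "f v \<in> carrier_vec r" for v by (simp add: f_def)
  ultimately have rn: "r + subspace_dim N {v \<in> carrier_vec N. f v = 0\<^sub>v r} = N"
    and ker: "VectorSpace.subspace class_ring {v \<in> carrier_vec N. f v = 0\<^sub>v r} (cvs N)"
    using linear_rank_nullity[OF V, of f r] by (simp_all add: subspace_dim_carrier)
  have "T \<subseteq> {v \<in> carrier_vec N. f v = 0\<^sub>v r}"
    using subspaceD(1)[OF T] by (auto simp: f_def zero eS)
  from subspace_dim_mono[OF T ker this] show ?thesis using rn r_def by simp
qed

text \<open>The rank is the size of a maximal independent set of columns. Such a set avoids the zero
  vector, so all its members come from indices in \<open>S\<close>.\<close>

lemma rank_le_nonzero_cols: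
  fixes A :: "complex mat"
  assumes A: "A \<in> carrier_mat nr nc" and S: "finite S"
    and zero: "\<And>j. j < nc \<Longrightarrow> j \<notin> S \<Longrightarrow> col A j = 0\<^sub>v nr"
  shows "vec_space.rank nr A \<le> card S"
proof -
  interpret vec_space "TYPE(complex)" nr .
  have "lin_indpt {}" by (auto simp: lin_dep_def)
  then obtain B where B: "finite B" "maximal B (\<lambda>T. T \<subseteq> set (cols A) \<and> lin_indpt T)"
    using maximal_exists_superset[of "set (cols A)" "\<lambda>T. T \<subseteq> set (cols A) \<and> lin_indpt T" "{}"] by auto
  then have BA: "B \<subseteq> set (cols A)" "lin_indpt B" unfolding maximal_def by auto
  have cA: "set (cols A) \<subseteq> carrier_vec nr" using cols_dim[of A] A by auto
  have "B \<subseteq> col A ` S"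
  proof
    fix v assume v: "v \<in> B"
    then have "v \<noteq> 0\<^sub>v nr" using vs_zero_lin_dep[of B] BA cA by auto
    moreover obtain j where "j < nc" "v = col A j"
      using v BA(1) A by (auto simp: cols_def)
    ultimately show "v \<in> col A ` S" using zero by auto
  qed
  then have "card B \<le> card S" using S by (meson card_image_le card_mono finite_imageI le_trans)
  then show ?thesis using rank_card_indpt[OF A B(2)] by simp
qed

section \<open>Coordinate projections and Schubert rank conditions\<close>

lemma pick_lessThan: "i < j \<Longrightarrow> pick {..<j} i = i"
proof -
  assume i: "i < j"
  have "{a \<in> {..<j}. a < i} = {..<i}" using i by auto
  then show ?thesis using pick_card_in_set[of i "{..<j}"] i by simp
qed

lemma coord_proj_lessThan: "coord_proj {..<j} v = vec j (\<lambda>i. v $ i)"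
  by (auto simp: coord_proj_def pick_lessThan)

lemma subspace_coord_proj:
  assumes "VectorSpace.subspace class_ring W (cvs n)" "j \<le> n"
  shows "VectorSpace.subspace class_ring (coord_proj {..<j} ` W) (cvs j)"
  by (rule linear_rank_nullity(3)[OF assms(1)])
    (use subspaceD(1)[OF assms(1)] assms(2) in \<open>auto simp: coord_proj_lessThan intro!: eq_vecI\<close>)

text \<open>If the minor vanished, some nonzero \<open>w\<close> in \<open>W\<close> would vanish in
  all columns of \<open>J\<close>. Its first nonzero position \<open>m\<close> then lies outside
  \<open>J\<close>, yet \<open>w\<close> makes the dimension of the projection grow on passing from
  the first \<open>m\<close> to the first \<open>m + 1\<close> coordinates, where the rank condition
  allows no jump.\<close>

lemma schubert_minor_nonzero:
  assumes M: "M \<in> carrier_mat k n" and J: "J \<in> ksubsets n k"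
    and W: "VectorSpace.subspace class_ring W (cvs n)" "row_span n M = W"
    and inj: "\<And>v. v \<in> carrier_vec k \<Longrightarrow> M\<^sup>T *\<^sub>v v = 0\<^sub>v n \<Longrightarrow> v = 0\<^sub>v k"
    and dims: "\<And>j. j \<le> n \<Longrightarrow> subspace_dim j (coord_proj {..<j} ` W) = card (J \<inter> {..<j})"
  shows "minor_cols J M \<noteq> 0"
proof
  assume "minor_cols J M = 0"
  let ?H = "submatrix M UNIV J"
  have H: "?H \<in> carrier_mat k k" by (simp add: submatrix_columns[OF M J])
  have "det ?H\<^sup>T = 0" using \<open>minor_cols J M = 0\<close> by (simp add: minor_cols_def det_transpose[OF H])
  then obtain v where v: "v \<in> carrier_vec k" "v \<noteq> 0\<^sub>v k" "?H\<^sup>T *\<^sub>v v = 0\<^sub>v k"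
    using det_0_iff_vec_prod_zero_field[OF transpose_carrier_mat[THEN iffD2, OF H]] by blast
  define w where "w = M\<^sup>T *\<^sub>v v"
  have w: "w \<in> carrier_vec n" using M v by (simp add: w_def)
  have wW: "w \<in> W"
    unfolding W(2)[symmetric] vec_space.row_space_eq[OF M] using M v w by (auto simp: w_def)
  have "w \<noteq> 0\<^sub>v n" using inj[OF v(1)] v(2) by (auto simp: w_def)
  then obtain i where "i < n \<and> w $ i \<noteq> 0"
    using w by (metis carrier_vecD eq_vecI index_zero_vec)
  define m where "m = (LEAST i. i < n \<and> w $ i \<noteq> 0)"
  have m: "m < n" "w $ m \<noteq> 0" using LeastI[of "\<lambda>i. i < n \<and> w $ i \<noteq> 0", OF \<open>i < n \<and> w $ i \<noteq> 0\<close>] by (simp_all add: m_def)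
  have below: "w $ i = 0" if "i < m" for i
    using not_less_Least[of i "\<lambda>i. i < n \<and> w $ i \<noteq> 0"] that m(1) unfolding m_def by auto
  have "m \<notin> J"
  proof
    assume "m \<in> J"
    then obtain p where p: "p < k" "m = pick J p" using ksubsets_pickE[OF J] by blast
    have "w $ m = (?H\<^sup>T *\<^sub>v v) $ p"
      using p v(1) M m(1) by (simp add: w_def submatrix_columns[OF M J] scalar_prod_def)
    then show False using m(2) v(3) p by simp
  qed
  let ?W = "coord_proj {..<Suc m} ` W"
  \<comment> \<open>\<open>f\<close> drops the last of the \<open>Suc m\<close> coordinates, which
    is position \<open>m\<close> since counting starts at 0. The projection of \<open>w\<close> is a
    nonzero vector of its kernel.\<close>
  define f where "f u = vec m (\<lambda>i. u $ i)" for u :: "complex vec"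
  have sW: "VectorSpace.subspace class_ring ?W (cvs (Suc m))"
    using m by (intro subspace_coord_proj[OF W(1)]) auto
  have "f (coord_proj {..<Suc m} u) = coord_proj {..<m} u" for u
    by (auto simp: f_def coord_proj_lessThan)
  then have fW: "f ` ?W = coord_proj {..<m} ` W" by (simp add: image_image)
  have c: "u \<in> carrier_vec (Suc m)" if "u \<in> ?W" for u using that subspaceD(1)[OF sW] by blast
  have lin: "f (u + u') = f u + f u'" "f (a \<cdot>\<^sub>v u) = a \<cdot>\<^sub>v f u" if "u \<in> ?W" "u' \<in> ?W" for u u' a
    using c[OF that(1)] c[OF that(2)] by (auto simp: f_def)
  let ?K = "{u \<in> ?W. f u = 0\<^sub>v m}"
  have rn: "subspace_dim m (f ` ?W) + subspace_dim (Suc m) ?K = subspace_dim (Suc m) ?W"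
    and sK: "VectorSpace.subspace class_ring ?K (cvs (Suc m))"
    using linear_rank_nullity[OF sW, of f m] lin by (auto simp: f_def)
  have "coord_proj {..<Suc m} w \<in> ?K"
    using wW below by (auto simp: f_def coord_proj_lessThan)
  moreover have "coord_proj {..<Suc m} w \<noteq> 0\<^sub>v (Suc m)"
    using m(2) by (metis coord_proj_lessThan index_vec index_zero_vec(1) lessI)
  ultimately have "0 < subspace_dim (Suc m) ?K" by (rule subspace_dim_pos[OF sK])
  moreover have "J \<inter> {..<Suc m} = J \<inter> {..<m}" using \<open>m \<notin> J\<close> by (auto simp: less_Suc_eq)
  ultimately show False using rn dims[of m] dims[of "Suc m"] m(1) by (simp add: fW)
qed

section \<open>Injectivity of charts and the chart around a coordinate subspace\<close>

lemma chart_mat_injective: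
  assumes J: "J \<in> ksubsets n k" and v: "v \<in> carrier_vec k"
    and "(chart_mat n k J x)\<^sup>T *\<^sub>v v = 0\<^sub>v n"
  shows "v = 0\<^sub>v k"
proof (rule eq_vecI)
  fix i assume "i < dim_vec (0\<^sub>v k :: complex vec)"
  then have i: "i < k" by simp
  have "((chart_mat n k J x)\<^sup>T *\<^sub>v v) $ pick J i = (\<Sum>l\<in>{0..<k}. chart_mat n k J x $$ (l, pick J i) * v $ l)"
    using v pick_less[OF J i] by (simp add: scalar_prod_def)
  also have "\<dots> = (\<Sum>l\<in>{0..<k}. if l = i then v $ l else 0)"
    using i by (intro sum.cong) (auto simp: chart_mat_pick[OF J])
  finally show "v $ i = 0\<^sub>v k $ i" using i pick_less[OF J i] assms(3) by simp
qed (use v in simp)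

text \<open>All vectors of the coordinate subspace vanish outside \<open>J\<close>, hence so do the
  rows of the chart matrix. A column of \<open>J'\<close> contains an entry 1, so it must lie in
  \<open>J\<close>, and cardinality gives equality. The point thus lies in a single standard chart,
  as its origin.\<close>

lemma local_coords_coord_subspace:
  assumes J: "J \<in> ksubsets n k" and lc: "local_coords n k J' x (coord_subspace n J)"
  shows "J' = J" and "\<And>a b. a < k \<Longrightarrow> b < n \<Longrightarrow> b \<notin> J \<Longrightarrow> chart_mat n k J' x $$ (a, b) = 0"
proof -
  have J': "J' \<in> ksubsets n k" and rs: "row_span n (chart_mat n k J' x) = coord_subspace n J"
    using lc unfolding local_coords_def by auto
  define C :: "complex mat" where "C = mat k n (\<lambda>(i, j). if j = pick J i then 1 else 0)"
  have C: "C \<in> carrier_mat k n" by (simp add: C_def)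
  have off: "w $ b = 0" if w: "w \<in> coord_subspace n J" and b: "b < n" "b \<notin> J" for w b
  proof -
    have "coord_subspace n J = row_span n C" using ksubsetsD(3)[OF J] by (simp add: coord_subspace_def C_def)
    then obtain v where v: "v \<in> carrier_vec k" "w = C\<^sup>T *\<^sub>v v"
      using w C by (auto simp: vec_space.row_space_eq[OF C])
    show ?thesis using v b pick_less[OF J] by (auto simp: C_def scalar_prod_def intro!: sum.neutral)
  qed
  show zero: "chart_mat n k J' x $$ (a, b) = 0" if "a < k" "b < n" "b \<notin> J" for a b
  proof -
    let ?M = "chart_mat n k J' x"
    interpret vec_space "TYPE(complex)" n .
    have "row ?M a \<in> row_space ?M"
      unfolding row_space_def using that rows_carrier[of ?M]
      by (intro span_mem) (auto simp: rows_def)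
    then show ?thesis using off[of "row ?M a" b] that rs by simp
  qed
  have "J' \<subseteq> J"
  proof
    fix l assume "l \<in> J'"
    then obtain i where i: "i < k" "l = pick J' i" using ksubsets_pickE[OF J'] by blast
    then show "l \<in> J"
      using zero[of i l] chart_mat_pick[OF J' i(1) i(1), of x] pick_less[OF J' i(1)] by auto
  qed
  then show "J' = J" using card_subset_eq[of J J'] ksubsetsD[OF J] ksubsetsD[OF J'] by simp
qed

text \<open>Along the coordinate line of \<open>q\<close> the chart matrix has only one possibly
  nonzero entry outside the columns \<open>J\<close>. Any \<open>I\<close> other than
  \<open>J\<close> and the exchanged set then selects a zero column or leaves a zero row, so the
  minor is identically zero on that line.\<close>

lemma minor_deriv_at_origin:
  assumes J: "J \<in> ksubsets n k" and I: "I \<in> ksubsets n k"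
    and x: "\<And>a b. a < k \<Longrightarrow> b < n \<Longrightarrow> b \<notin> J \<Longrightarrow> chart_mat n k J x $$ (a, b) = 0"
    and q: "q < k * (n - k)"
    and IJ: "I \<noteq> J" "I \<noteq> exchange J (coord_row n k q) (coord_col n k J q)"
  shows "partial_deriv q (\<lambda>x. minor_cols I (chart_mat n k J x)) x = 0"
proof -
  let ?a = "coord_row n k q" and ?b = "coord_col n k J q"
  note q_props = coord_props[OF J q]
  have "minor_cols I (chart_mat n k J (x(q := t))) = 0" for t
  proof -
    let ?M = "chart_mat n k J (x(q := t))"
    have off: "?M $$ (i, j) = 0" if "i < k" "j < n" "j \<notin> J" "(i, j) \<noteq> (?a, ?b)" for i j
      using x[OF that(1-3)] that coord_index_props[OF J that(1-3)]
      by (auto simp: chart_mat_coord)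
    show ?thesis
    proof (cases "I \<subseteq> insert ?b J")
      case False
      then obtain j where j: "j \<in> I" "j \<noteq> ?b" "j \<notin> J" by auto
      then have "j < n" using ksubsetsD(2)[OF I] by auto
      then show ?thesis using off j by (intro minor_cols_zero_col[OF _ I j(1)]) auto
    next
      case True
      \<comment> \<open>If \<open>I\<close> kept all of \<open>J\<close> except possibly its
        \<open>?a\<close>-th element, then by cardinality it would be the exchanged set or
        \<open>J\<close> itself. So \<open>I\<close> misses some other element of \<open>J\<close>,
        and the row with its pivot there becomes zero.\<close>
      have "\<not> J - {pick J ?a} \<subseteq> I"
      proof
        assume sub: "J - {pick J ?a} \<subseteq> I"
        note fin = ksubsetsD[OF I] ksubsetsD[OF J]
        have "\<not> exchange J ?a ?b \<subseteq> I"
          using card_subset_eq[of I "exchange J ?a ?b"] IJ(2) fin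
            ksubsetsD[OF exchange_ksubsets[OF J q_props(1-3)]] by auto
        then have "?b \<notin> I" using sub by (auto simp: exchange_def)
        then have "I \<subseteq> J" using True by auto
        then show False using card_subset_eq[of J I] IJ(1) fin by simp
      qed
      then obtain i where i: "i < k" "pick J i \<notin> I" "i \<noteq> ?a"
        using ksubsets_pickE[OF J] by (metis DiffD1 DiffD2 singletonI subsetI)
      have "?M $$ (i, j) = 0" if "j \<in> I" for j
      proof -
        have "j < n" using that ksubsetsD(2)[OF I] by auto
        then show ?thesis using off[of i j] i that
          by (cases "j \<in> J") (auto simp: chart_mat_in_J)
      qed
      then show ?thesis by (intro minor_cols_zero_row[OF _ I i(1)]) auto
    qed
  qed
  then show ?thesis by (simp add: partial_deriv_def)
qed

section \<open>Tangent vectors dual to the exchange minors\<close>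

text \<open>
  Writing \<open>M = H M\<^sub>0\<close> with \<open>M\<^sub>0\<close> in the chart of \<open>J\<^sub>0\<close>, the direction dual to the coordinate \<open>q\<close> of
  that chart is \<open>H E\<close> with \<open>E\<close> the matrix unit of \<open>q\<close>. Subtracting its component \<open>X M\<close> along the
  \<open>GL\<^sub>k\<close>-orbit of \<open>M\<close> brings it into the chart of \<open>J\<close> and does not affect the derivatives.
\<close>

lemma exchange_dual_vectors:
  assumes J: "J \<in> ksubsets n k" and J0: "J0 \<in> ksubsets n k"
    and S: "S \<subseteq> {..<k * (n - k)}"
    and nz: "minor_cols J0 (chart_mat n k J x) \<noteq> 0"
    and van: "\<And>q. q \<in> S \<Longrightarrow>
      minor_cols (exchange J0 (coord_row n k q) (coord_col n k J0 q)) (chart_mat n k J x) = 0"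
  obtains \<xi> :: "nat \<Rightarrow> complex vec" and \<mu> where "\<And>q. q \<in> S \<Longrightarrow> \<mu> q \<noteq> 0"
    and "\<And>q q'. q \<in> S \<Longrightarrow> q' \<in> S \<Longrightarrow>
      (\<Sum>p<k * (n - k). partial_deriv p (\<lambda>x. minor_cols
        (exchange J0 (coord_row n k q) (coord_col n k J0 q)) (chart_mat n k J x)) x * \<xi> q' $ p) =
      (if q = q' then \<mu> q else 0)"
proof -
  let ?a = "coord_row n k" and ?b = "coord_col n k J0"
  let ?I = "\<lambda>q. exchange J0 (?a q) (?b q)"
  define M where "M = chart_mat n k J x"
  have M: "M \<in> carrier_mat k n" by (simp add: M_def)
  have q_props: "?a q < k" "?b q < n" "?b q \<notin> J0" if "q \<in> S" for q
    using coord_props[OF J0] S that by auto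
  have I: "?I q \<in> ksubsets n k" if "q \<in> S" for q by (rule exchange_ksubsets[OF J0 q_props[OF that]])
  have "\<exists>\<kappa>. \<forall>q\<in>S. \<kappa> q \<noteq> 0 \<and> (\<forall>M\<in>carrier_mat k n.
      (\<forall>i<k. \<forall>j<k. M $$ (i, pick J0 j) = (if i = j then 1 else 0)) \<longrightarrow>
      minor_cols (?I q) M = \<kappa> q * M $$ (?a q, ?b q))"
  proof (rule bchoice, rule ballI)
    fix q assume "q \<in> S"
    from exchange_minor[OF J0 q_props[OF this]] obtain c where "c \<noteq> 0"
      "\<And>M. M \<in> carrier_mat k n \<Longrightarrow>
        (\<And>i j. i < k \<Longrightarrow> j < k \<Longrightarrow> M $$ (i, pick J0 j) = (if i = j then 1 else 0)) \<Longrightarrow>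
        minor_cols (?I q) M = c * M $$ (?a q, ?b q)" by blast
    then show "\<exists>c. c \<noteq> 0 \<and> (\<forall>M\<in>carrier_mat k n.
      (\<forall>i<k. \<forall>j<k. M $$ (i, pick J0 j) = (if i = j then 1 else 0)) \<longrightarrow>
      minor_cols (?I q) M = c * M $$ (?a q, ?b q))" by (intro exI[of _ c]) auto
  qed
  then obtain \<kappa> where \<kappa>_nz: "\<And>q. q \<in> S \<Longrightarrow> \<kappa> q \<noteq> 0"
    and \<kappa>: "\<And>q M. q \<in> S \<Longrightarrow> M \<in> carrier_mat k n \<Longrightarrow>
      \<forall>i<k. \<forall>j<k. M $$ (i, pick J0 j) = (if i = j then 1 else 0) \<Longrightarrow>
      minor_cols (?I q) M = \<kappa> q * M $$ (?a q, ?b q)" by blast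
  \<comment> \<open>The block of \<open>M\<close> in the columns \<open>J0\<close> is invertible by
    \<open>nz\<close>; its inverse \<open>g\<close> is built from the adjugate and carries
    \<open>M\<close> into the chart of \<open>J0\<close>.\<close>
  define H where "H = submatrix M UNIV J0"
  have H: "H \<in> carrier_mat k k" by (simp add: H_def submatrix_columns[OF M J0])
  have dH: "det H \<noteq> 0" using nz by (simp add: H_def M_def minor_cols_def)
  define g where "g = (1 / det H) \<cdot>\<^sub>m adj_mat H"
  have g: "g \<in> carrier_mat k k" using adj_mat(1)[OF H] by (simp add: g_def)
  have Hg: "H * g = 1\<^sub>m k" and gH: "g * H = 1\<^sub>m k"
    using adj_mat[OF H] dH H
    by (auto simp: g_def mult_smult_distrib[OF H] mult_smult_assoc_mat[of _ k k] intro!: eq_matI)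
  define M0 where "M0 = g * M"
  have M0: "M0 \<in> carrier_mat k n" using g M by (simp add: M0_def)
  have M0J: "M0 $$ (i, pick J0 j) = (if i = j then 1 else 0)" if "i < k" "j < k" for i j
  proof -
    have "M0 $$ (i, pick J0 j) = (g * H) $$ (i, j)"
      using that g M pick_less[OF J0 that(2)]
      by (simp add: M0_def H_def submatrix_columns[OF M J0] scalar_prod_def)
    then show ?thesis using that by (simp add: gH)
  qed
  have HM0: "H * M0 = M"
    using assoc_mult_mat[OF H g M] M by (simp add: M0_def Hg)
  define E :: "nat \<Rightarrow> complex mat" where
    "E q = mat k n (\<lambda>(i, j). if i = ?a q \<and> j = ?b q then 1 else 0)" for q
  have E: "E q \<in> carrier_mat k n" for q by (simp add: E_def)
  have HE: "H * E q \<in> carrier_mat k n" for q by (rule mult_carrier_mat[OF H E])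
  have deriv_HE: "minor_deriv k n (?I q) M (H * E q') = (if q = q' then det H * \<kappa> q else 0)"
    if q: "q \<in> S" and q': "q' \<in> S" for q q'
  proof -
    \<comment> \<open>The line factors as \<open>H (M0 + t E)\<close>, and the second factor stays
      in the chart of \<open>J0\<close>. There the exchange minor is a multiple of one entry, which
      depends on \<open>t\<close> only if \<open>q = q'\<close>.\<close>
    have eq: "minor_cols (?I q) (M + t \<cdot>\<^sub>m (H * E q')) =
      det H * \<kappa> q * (M0 $$ (?a q, ?b q) + t * (if q = q' then 1 else 0))" for t
    proof -
      have "M + t \<cdot>\<^sub>m (H * E q') = H * (M0 + t \<cdot>\<^sub>m E q')"
        using mult_add_distrib_mat[OF H M0, of "t \<cdot>\<^sub>m E q'"] mult_smult_distrib[OF H E] E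
        by (simp add: HM0)
      moreover have "minor_cols (?I q) (M0 + t \<cdot>\<^sub>m E q') = \<kappa> q * (M0 + t \<cdot>\<^sub>m E q') $$ (?a q, ?b q)"
      proof (rule \<kappa>[OF q])
        show "\<forall>i<k. \<forall>j<k. (M0 + t \<cdot>\<^sub>m E q') $$ (i, pick J0 j) = (if i = j then 1 else 0)"
        proof (intro allI impI)
          fix i j assume ij: "i < k" "j < k"
          then have "pick J0 j \<noteq> ?b q'" using pick_less(2)[OF J0] q_props(3)[OF q'] by metis
          then show "(M0 + t \<cdot>\<^sub>m E q') $$ (i, pick J0 j) = (if i = j then 1 else 0)"
            using M0 ij pick_less(1)[OF J0] by (simp add: E_def M0J)
        qed
      qed (use M0 E in simp)
      moreover have "(M0 + t \<cdot>\<^sub>m E q') $$ (?a q, ?b q) =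
        M0 $$ (?a q, ?b q) + t * (if q = q' then 1 else 0)"
      proof -
        have "?a q = ?a q' \<and> ?b q = ?b q' \<longleftrightarrow> q = q'"
          using coord_props(4)[OF J0] S q q' by (metis lessThan_iff subsetD)
        then show ?thesis using M0 q_props[OF q] by (simp add: E_def)
      qed
      ultimately show ?thesis
        using minor_cols_mult[OF H _ I[OF q], of "M0 + t \<cdot>\<^sub>m E q'"] M0 E by simp
    qed
    have "((\<lambda>t. det H * \<kappa> q * (M0 $$ (?a q, ?b q) + t * (if q = q' then 1 else 0)))
      has_field_derivative (if q = q' then det H * \<kappa> q else 0)) (at 0)"
      by (auto intro!: derivative_eq_intros)
    then show ?thesis by (rule DERIV_unique[OF minor_deriv[OF I[OF q] M HE[of q'], unfolded eq]])
  qed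
  \<comment> \<open>Since \<open>M\<close> is the identity in the columns \<open>J\<close>, the
    product \<open>X q * M\<close> has there the same entries as \<open>H * E q\<close>, and the
    difference vanishes on \<open>J\<close>.\<close>
  define X where "X q = submatrix (H * E q) UNIV J" for q
  have X: "X q \<in> carrier_mat k k" for q by (simp add: X_def submatrix_columns[OF HE J])
  define P where "P q = H * E q - X q * M" for q
  have XM: "X q * M \<in> carrier_mat k n" for q by (rule mult_carrier_mat[OF X M])
  have P: "P q \<in> carrier_mat k n" for q unfolding P_def by (rule minus_carrier_mat[OF XM])
  have PJ: "P q $$ (i, j) = 0" if i: "i < k" and j: "j \<in> J" for q i j
  proof -
    obtain l where l: "l < k" "j = pick J l" using ksubsets_pickE[OF J j] .
    have jn: "j < n" using j ksubsetsD(2)[OF J] by auto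
    have "(X q * M) $$ (i, j) = (\<Sum>c\<in>{0..<k}. X q $$ (i, c) * M $$ (c, j))"
      using X[of q] M i jn by (auto simp: scalar_prod_def intro!: sum.cong)
    also have "\<dots> = (\<Sum>c\<in>{0..<k}. if c = l then X q $$ (i, c) else 0)"
      using l by (intro sum.cong) (auto simp: M_def chart_mat_pick[OF J])
    also have "\<dots> = (H * E q) $$ (i, j)"
      using l i by (simp add: X_def submatrix_columns[OF HE J])
    finally show ?thesis using X[of q] M i jn by (simp add: P_def)
  qed
  define \<xi> where "\<xi> q = vec (k * (n - k)) (\<lambda>p. P q $$ (coord_row n k p, coord_col n k J p))" for q
  show thesis
  proof
    fix q assume "q \<in> S"
    then show "det H * \<kappa> q \<noteq> 0" using dH \<kappa>_nz by simp
    fix q' assume q': "q' \<in> S"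
    have "(\<Sum>p<k * (n - k). partial_deriv p (\<lambda>x. minor_cols (?I q) (chart_mat n k J x)) x * \<xi> q' $ p) =
      minor_deriv k n (?I q) M (P q')"
      using minor_chart_deriv[OF I[OF \<open>q \<in> S\<close>] J P[of q'] PJ, of x] by (simp add: \<xi>_def M_def)
    also have "\<dots> = minor_deriv k n (?I q) M (H * E q')"
      unfolding P_def minor_deriv_minus[OF HE XM]
      using minor_deriv_orbit[OF I[OF \<open>q \<in> S\<close>] M X] van[OF \<open>q \<in> S\<close>] by (simp add: M_def)
    finally show "(\<Sum>p<k * (n - k). partial_deriv p (\<lambda>x. minor_cols (?I q) (chart_mat n k J x)) x * \<xi> q' $ p) =
      (if q = q' then det H * \<kappa> q else 0)" using deriv_HE[OF \<open>q \<in> S\<close> q'] by simp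
  qed
qed

section \<open>Comparison of the Jacobian rank with the tangent codimension\<close>

lemma subspace_tangent_space:
  "VectorSpace.subspace class_ring (tangent_space n k Z J x) (cvs (k * (n - k)))"
proof (rule subspaceI)
  fix v w assume v: "v \<in> tangent_space n k Z J x" and w: "w \<in> tangent_space n k Z J x"
  then show "v + w \<in> tangent_space n k Z J x"
    by (auto simp: tangent_space_def distrib_left sum.distrib)
next
  fix c v assume v: "v \<in> tangent_space n k Z J x"
  then have "(\<Sum>q<k * (n - k). partial_deriv q f x * (c \<cdot>\<^sub>v v) $ q) =
      c * (\<Sum>q<k * (n - k). partial_deriv q f x * v $ q)" for f
    by (auto simp: tangent_space_def sum_distrib_left mult.left_commute intro!: sum.cong)
  then show "c \<cdot>\<^sub>v v \<in> tangent_space n k Z J x" using v by (auto simp: tangent_space_def)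
qed (auto simp: tangent_space_def)

lemma nonbasesD:
  assumes "I \<in> set (nonbases n k d)"
  shows "I \<in> ksubsets n k" "I \<notin> positroid n k d"
proof -
  have "I \<in> set ` set (subseqs [0..<n])" using assms by (auto simp: nonbases_def)
  then have "I \<subseteq> {..<n}" unfolding subseqs_powset by auto
  then show "I \<in> ksubsets n k" "I \<notin> positroid n k d"
    using assms by (auto simp: nonbases_def ksubsets_def)
qed

theorem theorem1p3:
  fixes n k :: nat and d :: dperm and y :: "nat \<Rightarrow> nat"
    and V :: "nat \<Rightarrow> complex vec set" and A :: "complex vec set"
    and J J' :: "nat set" and x x' :: "nat \<Rightarrow> complex"
  assumes "k \<le> n"
    and "d \<in> decorated_perms n k"
    and "y \<in> bruhat_interval n (lower_perm n k d) (upper_perm n k d)"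
    and "V \<in> schubert_cell n y \<inter> opposite_schubert_variety n (upper_perm n k d)"
    and "A = flag_proj k V"
    and "A \<in> positroid_variety n k d"
    and "local_coords n k J x A"
    and "local_coords n k J' x' (coord_subspace n (y ` {..<k}))"
  shows "tangent_codim n k (positroid_variety n k d) J x \<ge> mat_rank (Jac n k d J' x')"
proof -
  define J0 where "J0 = y ` {..<k}"
  define N where "N = k * (n - k)"
  define M where "M = chart_mat n k J x"
  define E where "E q = exchange J0 (coord_row n k q) (coord_col n k J0 q)" for q
  \<comment> \<open>The coordinates around \<open>J0\<close> whose exchanged set is a nonbasis.
    Their number separates the two sides: it bounds the Jacobian rank from above and the codimension
    from below.\<close>
  define S where "S = {q. q < N \<and> E q \<notin> positroid n k d}"
  let ?Z = "positroid_variety n k d"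
  have y: "y permutes {..<n}" using assms(3) by (simp add: bruhat_interval_def)
  have "J0 \<subseteq> {..<n}"
    unfolding J0_def using assms(1) permutes_image[OF y] by (metis image_mono lessThan_subset_iff)
  moreover have "card J0 = k" unfolding J0_def using card_image[OF permutes_inj_on[OF y]] by simp
  ultimately have J0: "J0 \<in> ksubsets n k" by (simp add: ksubsets_def)
  have J: "J \<in> ksubsets n k" and MA: "row_span n M = A"
    using assms(7) by (simp_all add: local_coords_def M_def)
  have sA: "VectorSpace.subspace class_ring A (cvs n)"
    using assms(6) by (simp add: positroid_variety_def Gr_def)
  have M: "M \<in> carrier_mat k n" by (simp add: M_def)
  have vanish: "minor_cols I M' = 0"
    if "I \<in> ksubsets n k" "I \<notin> positroid n k d" "M' \<in> carrier_mat k n" "row_span n M' \<in> ?Z" for I M'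
    using that by (auto simp: positroid_variety_def)
  have nz: "minor_cols J0 M \<noteq> 0"
  proof (rule schubert_minor_nonzero[OF M J0 sA MA])
    show "v = 0\<^sub>v k" if "v \<in> carrier_vec k" "M\<^sup>T *\<^sub>v v = 0\<^sub>v n" for v
      using chart_mat_injective[OF J that(1)] that(2) by (simp add: M_def)
    show "subspace_dim j (coord_proj {..<j} ` A) = card (J0 \<inter> {..<j})" if "j \<le> n" for j
      using assms(1,4,5) that by (simp add: schubert_cell_def flag_proj_def J0_def)
  qed
  \<comment> \<open>All nonbasis minors vanish at \<open>A\<close>, but the minor of
    \<open>J0\<close> does not. Hence no row of the Jacobian belongs to \<open>J0\<close>.\<close>
  have J0_basis: "J0 \<in> positroid n k d"
    using vanish[OF J0 _ M] nz MA assms(6) by auto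
  have EI: "E q \<in> ksubsets n k" if "q \<in> S" for q
    using coord_props[OF J0, of q] that exchange_ksubsets[OF J0] by (simp add: S_def N_def E_def)

  have J': "J' = J0"
    and x': "\<And>a b. a < k \<Longrightarrow> b < n \<Longrightarrow> b \<notin> J0 \<Longrightarrow> chart_mat n k J0 x' $$ (a, b) = 0"
    using local_coords_coord_subspace[OF J0, of J' x'] assms(8) by (auto simp: J0_def)
  have "mat_rank (Jac n k d J' x') \<le> card S"
  proof -
    let ?D = "Jac n k d J' x'"
    have D: "?D \<in> carrier_mat (length (nonbases n k d)) N"
      by (simp add: Jac_def jacobian_def N_def)
    \<comment> \<open>For \<open>q\<close> outside \<open>S\<close> both \<open>J0\<close> and
      \<open>E q\<close> are bases, so each nonbasis differs from both and its derivative in the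
      direction \<open>q\<close> is zero at the origin.\<close>
    have "col ?D q = 0\<^sub>v (length (nonbases n k d))" if "q < N" "q \<notin> S" for q
    proof (rule eq_vecI)
      fix i assume "i < dim_vec (0\<^sub>v (length (nonbases n k d)) :: complex vec)"
      then have i: "i < length (nonbases n k d)" by simp
      let ?I = "nonbases n k d ! i"
      have I: "?I \<in> ksubsets n k" "?I \<notin> positroid n k d"
        using nonbasesD[of ?I] nth_mem[OF i] by auto
      have "col ?D q $ i = partial_deriv q (\<lambda>x. minor_cols ?I (chart_mat n k J0 x)) x'"
        using i that(1) by (simp add: Jac_def jacobian_def N_def J')
      also have "\<dots> = 0"
        using I J0_basis that by (intro minor_deriv_at_origin[OF J0 I(1) x']) (auto simp: S_def N_def E_def)
      finally show "col ?D q $ i = 0\<^sub>v (length (nonbases n k d)) $ i" using i by simp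
    qed (use D in simp)
    from rank_le_nonzero_cols[OF D _ this, of S] show ?thesis
      using D by (simp add: mat_rank_def S_def)
  qed
  also have "card S \<le> tangent_codim n k ?Z J x"
  proof -
    let ?f = "\<lambda>q x. minor_cols (E q) (chart_mat n k J x)"
    obtain \<xi> :: "nat \<Rightarrow> complex vec" and \<mu> where \<mu>: "\<And>q. q \<in> S \<Longrightarrow> \<mu> q \<noteq> 0"
      and dual: "\<And>q q'. q \<in> S \<Longrightarrow> q' \<in> S \<Longrightarrow>
        (\<Sum>p<k * (n - k). partial_deriv p (?f q) x * \<xi> q' $ p) = (if q = q' then \<mu> q else 0)"
    proof (rule exchange_dual_vectors[OF J J0, of S x, folded E_def M_def])
      show "S \<subseteq> {..<k * (n - k)}" by (auto simp: S_def N_def)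
      show "minor_cols J0 M \<noteq> 0" by (rule nz)
      show "minor_cols (E q) M = 0" if "q \<in> S" for q
        using vanish[OF EI[OF that] _ M] that MA assms(6) by (auto simp: S_def)
    qed (use that in blast)
    \<comment> \<open>The exchange minors indexed by \<open>S\<close> vanish on the whole positroid
      variety within the chart, so their differentials annihilate every tangent vector at
      \<open>A\<close>.\<close>
    have "?f q \<in> local_vanishing_ideal n k ?Z J" if "q \<in> S" for q
      using minor_chart_poly_funs[OF EI[OF that] J] vanish[OF EI[OF that]] that
      by (auto simp: local_vanishing_ideal_def S_def)
    then have "(\<Sum>p<k * (n - k). partial_deriv p (?f q) x * \<tau> $ p) = 0"
      if "q \<in> S" "\<tau> \<in> tangent_space n k ?Z J x" for q \<tau>
      using that by (auto simp: tangent_space_def)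
    moreover have "finite S" by (simp add: S_def)
    ultimately have "card S + subspace_dim (k * (n - k)) (tangent_space n k ?Z J x) \<le> k * (n - k)"
      using dual \<mu>
      by (intro codim_ge_functionals[OF subspace_tangent_space,
            where c = "\<lambda>q p. partial_deriv p (?f q) x" and \<xi> = \<xi> and \<mu> = \<mu>]) auto
    \<comment> \<open>The additive bound gives the claim despite the truncated subtraction in
      \<open>tangent_codim\<close>.\<close>
    then show ?thesis by (simp add: tangent_codim_def)
  qed
  finally show ?thesis .
qed

end
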